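(* Let $(R,\mathfrak m)$ be a Noetherian local ring and let $I=aR$ be a principal ideal of $R$. For $n\ge 0$ put $h^0_I(n)=\ell_R(H^0_{\mathfrak m}(R/I^{n+1}))$. Then there is a polynomial $P_I(n)$ with $\deg P_I(n)\le 1$ such that $P_I(n)=h^0_I(n)$ for all $n\gg 0$.
   Context: $\ell_R$ denotes length of $R$-modules and $H^0_{\mathfrak m}$ the zeroth local cohomology functor with support in $\mathfrak m$, so $H^0_{\mathfrak m}(R/I^{n+1})=\bigcup_{s>0}(I^{n+1}:_R\mathfrak m^s)/I^{n+1}$. *)

theory Defs
  imports
    "HOL-Algebra.Module"
    "HOL-Algebra.QuotRing"
    "HOL-Algebra.Ideal_Product"
    "HOL-Algebra.Ring_Divisibility"
    "HOL-Library.Extended_Nat"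
    "HOL-Computational_Algebra.Polynomial"
begin

text \<open>A local ring \<open>(R, m)\<close> is nonzero, because maximal ideals are proper.\<close>

locale noetherian_local_ring =
  cring R + noetherian_ring R + maximalideal m R for R (structure) and m +
  assumes maximal_unique: "maximalideal n R \<Longrightarrow> n = m"

text \<open>Powers of an ideal are powers in the semiring \<^const>\<open>ideals_set\<close> of all ideals,
  so the zeroth power is the whole ring.\<close>

abbreviation ideal_power :: "('a, 'b) ring_scheme \<Rightarrow> 'a set \<Rightarrow> nat \<Rightarrow> 'a set" where
  "ideal_power R I k \<equiv> I [^]\<^bsub>ideals_set R\<^esub> k"

text \<open>The ring \<open>R Quot J\<close>, with \<open>R\<close> acting through the projection \<open>r \<mapsto> J + r\<close>.\<close>

definition quot_module :: "('a, 'b) ring_scheme \<Rightarrow> 'a set \<Rightarrow> ('a, 'a set) module" where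
  "quot_module R J =
    ring.extend (R Quot J) (module.fields (\<lambda>r X. (J +>\<^bsub>R\<^esub> r) \<otimes>\<^bsub>R Quot J\<^esub> X))"

lemma quot_module_simps [simp]:
  "carrier (quot_module R J) = carrier (R Quot J)"
  "zero (quot_module R J) = zero (R Quot J)"
  "add (quot_module R J) = add (R Quot J)"
  "r \<odot>\<^bsub>quot_module R J\<^esub> X = (J +>\<^bsub>R\<^esub> r) \<otimes>\<^bsub>R Quot J\<^esub> X"
  by (simp_all add: quot_module_def ring.extend_def module.fields_def)

text \<open>The supremum of the lengths of the strict chains of submodules from \<open>0\<close> to \<open>M\<close>;
  it is \<open>\<infinity>\<close> if \<open>M\<close> does not have finite length.\<close>

definition module_length ::
  "('a, 'b) ring_scheme \<Rightarrow> ('a, 'c, 'd) module_scheme \<Rightarrow> enat" where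
  "module_length R M =
    Sup {enat n | n. \<exists>N :: nat \<Rightarrow> 'c set.
      N 0 = {\<zero>\<^bsub>M\<^esub>} \<and> N n = carrier M \<and>
      (\<forall>i\<le>n. submodule (N i) R M) \<and> (\<forall>i<n. N i \<subset> N (Suc i))}"

text \<open>The submodule of all elements killed by some power of \<open>m\<close>.\<close>

definition local_cohomology0 ::
  "('a, 'b) ring_scheme \<Rightarrow> 'a set \<Rightarrow> ('a, 'c, 'd) module_scheme \<Rightarrow> ('a, 'c, 'd) module_scheme" where
  "local_cohomology0 R m M =
    M\<lparr>carrier := {x \<in> carrier M. \<exists>s>0. \<forall>r \<in> ideal_power R m s. r \<odot>\<^bsub>M\<^esub> x = \<zero>\<^bsub>M\<^esub>}\<rparr>"

definition h0 :: "('a, 'b) ring_scheme \<Rightarrow> 'a set \<Rightarrow> 'a set \<Rightarrow> nat \<Rightarrow> enat" where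
  "h0 R m I n =
    module_length R (local_cohomology0 R m (quot_module R (ideal_power R I (n + 1))))"

lemma (in cring) ideal_power_ideal:
  assumes "ideal I R"
  shows "ideal (ideal_power R I k) R"
proof -
  interpret S: comm_monoid "ideals_set R" by (rule ideals_set_is_comm_monoid)
  have "I \<in> carrier (ideals_set R)" using assms by (simp add: ideals_set_def)
  then have "ideal_power R I k \<in> carrier (ideals_set R)" by (rule S.nat_pow_closed)
  then show ?thesis by (simp add: ideals_set_def)
qed

lemma (in cring) quot_module_is_module:
  assumes "ideal J R"
  shows "module R (quot_module R J)"
proof -
  interpret J: ideal J R by (rule assms)
  interpret Q: cring "R Quot J" by (rule J.quotient_is_cring[OF is_cring])
  have h: "(+>) J \<in> ring_hom R (R Quot J)" by (rule J.rcos_ring_hom)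
  have ab: "abelian_group (quot_module R J)"
  proof (rule abelian_groupI)
    fix x assume "x \<in> carrier (quot_module R J)"
    then show "\<exists>y\<in>carrier (quot_module R J).
        y \<oplus>\<^bsub>quot_module R J\<^esub> x = \<zero>\<^bsub>quot_module R J\<^esub>"
      by (intro bexI[of _ "\<ominus>\<^bsub>R Quot J\<^esub> x"]) (auto simp: Q.l_neg)
  qed (simp_all add: Q.add.m_ac)
  show ?thesis
    by (rule moduleI[OF is_cring ab])
      (simp_all add: ring_hom_closed[OF h] ring_hom_add[OF h] ring_hom_mult[OF h]
        ring_hom_one[OF h] Q.l_distr Q.r_distr Q.m_assoc)
qed

text \<open>For \<open>M = R/J\<close> the functor is the union over \<open>s\<close> of \<open>(J : m\<^sup>s)/J\<close>.\<close>

lemma (in cring) carrier_local_cohomology0_quot: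
  assumes J: "ideal J R" and m: "ideal m R"
  shows "carrier (local_cohomology0 R m (quot_module R J)) =
    (\<lambda>x. J +> x) ` (\<Union>s\<in>{0<..}. {x \<in> carrier R. \<forall>r \<in> ideal_power R m s. r \<otimes> x \<in> J})"
proof -
  interpret J: ideal J R by (rule J)
  have h: "(+>) J \<in> ring_hom R (R Quot J)" by (rule J.rcos_ring_hom)
  have pow: "r \<in> carrier R" if "r \<in> ideal_power R m s" for r s
    using ideal.Icarr[OF ideal_power_ideal[OF m] that] .
  have C: "carrier (R Quot J) = (\<lambda>x. J +> x) ` carrier R"
    by (auto simp: FactRing_def A_RCOSETS_def RCOSETS_def a_r_coset_def)
  have Z: "\<zero>\<^bsub>R Quot J\<^esub> = J" by (simp add: FactRing_def)
  have *: "(J +> r) \<otimes>\<^bsub>R Quot J\<^esub> (J +> x) = J \<longleftrightarrow> r \<otimes> x \<in> J"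
    if "r \<in> carrier R" "x \<in> carrier R" for r x
    unfolding ring_hom_mult[OF h that, symmetric]
    by (meson J.a_rcos_const J.rcos_const_imp_mem m_closed that)
  show ?thesis
  proof (rule Set.set_eqI)
    fix X
    have "X \<in> carrier (local_cohomology0 R m (quot_module R J)) \<longleftrightarrow>
        (\<exists>x\<in>carrier R. X = J +> x \<and>
          (\<exists>s>0. \<forall>r\<in>ideal_power R m s. (J +> r) \<otimes>\<^bsub>R Quot J\<^esub> (J +> x) = J))"
      by (auto simp: local_cohomology0_def C Z)
    also have "\<dots> \<longleftrightarrow> (\<exists>x\<in>carrier R. X = J +> x \<and>
          (\<exists>s>0. \<forall>r\<in>ideal_power R m s. r \<otimes> x \<in> J))"
      using * pow by (intro bex_cong refl conj_cong ex_cong1 ball_cong) auto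
    finally show "X \<in> carrier (local_cohomology0 R m (quot_module R J)) \<longleftrightarrow>
      X \<in> (\<lambda>x. J +> x) ` (\<Union>s\<in>{0<..}. {x \<in> carrier R. \<forall>r \<in> ideal_power R m s. r \<otimes> x \<in> J})"
      by auto
  qed
qed

end

theory Submission
  imports Defs
begin

text \<open>
  Write \<open>A\<^sub>n = a\<^sup>nR\<close> and let \<open>J\<^sub>n\<close> be its saturation, the ideal of all \<open>x\<close> with
  \<open>m\<^sup>s x \<subseteq> A\<^sub>n\<close> for some \<open>s\<close>. By the correspondence theorem the function in question is
  \<open>h\<^sub>n = \<ell>(J\<^sub>n/A\<^sub>n)\<close>, up to a shift of the index, where \<open>\<ell>\<close> is the length of an interval in the
  lattice of ideals of \<open>R\<close>. These lengths are finite because \<open>R\<close> is Noetherian.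

  Multiplication by \<open>a\<close> maps \<open>J\<^sub>n/A\<^sub>n\<close> to \<open>J\<^sub>n\<^sub>+\<^sub>1/A\<^sub>n\<^sub>+\<^sub>1\<close>. Its kernel is \<open>K\<^sub>n/A\<^sub>n\<close> with
  \<open>K\<^sub>n = {y \<in> J\<^sub>n. ay \<in> A\<^sub>n\<^sub>+\<^sub>1}\<close> and its cokernel is \<open>J\<^sub>n\<^sub>+\<^sub>1/aJ\<^sub>n\<close>, because \<open>A\<^sub>n\<^sub>+\<^sub>1 = aA\<^sub>n \<subseteq> aJ\<^sub>n\<close>.
  With \<open>c\<^sub>n = \<ell>(K\<^sub>n/A\<^sub>n)\<close> and \<open>d\<^sub>n = \<ell>(J\<^sub>n\<^sub>+\<^sub>1/aJ\<^sub>n)\<close> additivity of length gives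
  \<open>h\<^sub>n\<^sub>+\<^sub>1 + c\<^sub>n = h\<^sub>n + d\<^sub>n\<close>. It remains to see that \<open>c\<close> and \<open>d\<close> are eventually constant; then \<open>h\<close>
  grows by the fixed amount \<open>d - c\<close>.

  A sequence of natural numbers that decreases from some point on is eventually constant, so it is
  enough that the inclusions \<open>K\<^sub>n\<^sub>+\<^sub>1 \<subseteq> K\<^sub>n\<close> and \<open>J\<^sub>n\<^sub>+\<^sub>2 \<subseteq> J\<^sub>n\<^sub>+\<^sub>1\<close> induce injective maps
  \<open>K\<^sub>n\<^sub>+\<^sub>1/A\<^sub>n\<^sub>+\<^sub>1 \<rightarrow> K\<^sub>n/A\<^sub>n\<close> and \<open>J\<^sub>n\<^sub>+\<^sub>2/aJ\<^sub>n\<^sub>+\<^sub>1 \<rightarrow> J\<^sub>n\<^sub>+\<^sub>1/aJ\<^sub>n\<close> for large \<open>n\<close>. Both follow from one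
  cancellation property (\<open>cgenideal_power_cancel\<close>): if \<open>z \<in> A\<^sub>n\<close> and \<open>az \<in> A\<^sub>n\<^sub>+\<^sub>2\<close>, then
  \<open>z \<in> A\<^sub>n\<^sub>+\<^sub>1\<close>. It holds as soon as the ascending chain of the annihilators of \<open>a\<^sup>n\<close> has become
  stationary.
\<close>

text \<open>The symbol is needed for the sum of ideals.\<close>
no_notation Sum_Type.Plus (infixr \<open><+>\<close> 65)

section \<open>Lengths of intervals in a family of sets\<close>

text \<open>
  The last inclusion may be an equality. So the predicate says that some chain from \<open>A\<close> to \<open>B\<close> has at
  least \<open>k\<close> strict steps, and it survives shrinking \<open>A\<close> and enlarging \<open>B\<close>.
\<close>
primrec strict_chain :: "'a set set \<Rightarrow> nat \<Rightarrow> 'a set \<Rightarrow> 'a set \<Rightarrow> bool" where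
  "strict_chain F 0 A B \<longleftrightarrow> A \<in> F \<and> B \<in> F \<and> A \<subseteq> B"
| "strict_chain F (Suc k) A B \<longleftrightarrow> A \<in> F \<and> (\<exists>M\<in>F. A \<subset> M \<and> strict_chain F k M B)"

definition interval_length :: "'a set set \<Rightarrow> 'a set \<Rightarrow> 'a set \<Rightarrow> enat" where
  "interval_length F A B = Sup {enat k | k. strict_chain F k A B}"

lemma strict_chainD:
  assumes "strict_chain F k A B"
  shows "A \<in> F" "B \<in> F" "A \<subseteq> B"
proof -
  have "A \<in> F \<and> B \<in> F \<and> A \<subseteq> B"
    using assms by (induction k arbitrary: A) (simp, fastforce)
  then show "A \<in> F" "B \<in> F" "A \<subseteq> B" by blast+
qed

text \<open>
  A strictly monotone map of intervals carries chains to chains. Every isomorphism or embedding of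
  quotients \<open>B/A\<close> used below enters only through such a map of the intervals between \<open>A\<close> and \<open>B\<close>.
\<close>
lemma strict_chain_transport:
  assumes "strict_chain F k A B"
    and "\<And>X. X \<in> F \<Longrightarrow> A \<subseteq> X \<Longrightarrow> X \<subseteq> B \<Longrightarrow> f X \<in> G"
    and "\<And>X Y. X \<in> F \<Longrightarrow> Y \<in> F \<Longrightarrow> A \<subseteq> X \<Longrightarrow> X \<subset> Y \<Longrightarrow> Y \<subseteq> B \<Longrightarrow> f X \<subset> f Y"
    and "A' \<in> G" "B' \<in> G" "A' \<subseteq> f A" "f B \<subseteq> B'"
  shows "strict_chain G k A' B'"
  using assms
proof (induction k arbitrary: A A')
  case 0
  have "f A \<subseteq> f B"
    using 0(1) 0(3)[of A B] by (cases "A = B") auto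
  then show ?case using 0 by auto
next
  case (Suc k)
  from Suc.prems(1) obtain M where M: "A \<in> F" "M \<in> F" "A \<subset> M" "strict_chain F k M B"
    by auto
  note MB = strict_chainD[OF M(4)]
  have fM: "strict_chain G k (f M) B'"
  proof (rule Suc.IH[OF M(4)])
    show "f M \<in> G" using Suc.prems(2)[OF M(2)] M(3) MB(3) by blast
    show "f X \<in> G" if "X \<in> F" "M \<subseteq> X" "X \<subseteq> B" for X
      using Suc.prems(2)[OF that(1)] that M(3) by blast
    show "f X \<subset> f Y" if "X \<in> F" "Y \<in> F" "M \<subseteq> X" "X \<subset> Y" "Y \<subseteq> B" for X Y
      using Suc.prems(3)[OF that(1,2)] that M(3) by blast
  qed (use Suc.prems in auto)
  moreover have "f A \<subset> f M"
    using Suc.prems(3)[OF M(1,2)] M(3) MB(3) by blast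
  then have "A' \<subset> f M" using Suc.prems(6) by blast
  ultimately show ?case
    using Suc.prems(4) strict_chainD(1)[OF fM] by auto
qed

lemma strict_chain_mono:
  assumes "strict_chain F k A B" "A' \<in> F" "B' \<in> F" "A' \<subseteq> A" "B \<subseteq> B'"
  shows "strict_chain F k A' B'"
  by (rule strict_chain_transport[OF assms(1), where f = "\<lambda>X. X"]) (use assms in auto)

lemma strict_chain_less:
  assumes "strict_chain F k A B" "j \<le> k"
  shows "strict_chain F j A B"
  using assms(2,1)
proof (induction rule: inc_induct)
  case (step n)
  then obtain M where "A \<in> F" "A \<subset> M" "strict_chain F n M B" by auto
  then show ?case
    using strict_chain_mono strict_chainD(2) by blast
qed

lemma strict_chain_append:
  assumes "strict_chain F i A B" "strict_chain F j B C"
  shows "strict_chain F (i + j) A C"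
  using assms
proof (induction i arbitrary: A)
  case 0
  then show ?case using strict_chain_mono strict_chainD(2) by fastforce
qed auto

lemma strict_chain_iff_interval_length:
  assumes "A \<in> F" "B \<in> F" "A \<subseteq> B"
  shows "strict_chain F k A B \<longleftrightarrow> enat k \<le> interval_length F A B"
proof
  assume "strict_chain F k A B"
  then show "enat k \<le> interval_length F A B"
    unfolding interval_length_def by (intro Sup_upper) auto
next
  assume le: "enat k \<le> interval_length F A B"
  show "strict_chain F k A B"
  proof (rule ccontr)
    assume no: "\<not> strict_chain F k A B"
    have "k \<noteq> 0" using no assms by (intro notI) auto
    have "j < k" if "strict_chain F j A B" for j
      using strict_chain_less[OF that, of k] no by (cases "j < k") auto
    then have "interval_length F A B \<le> enat (k - 1)"
      unfolding interval_length_def by (intro Sup_least) fastforce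
    with le have "enat k \<le> enat (k - 1)" by (rule order_trans)
    with \<open>k \<noteq> 0\<close> show False by simp
  qed
qed

lemma interval_length_transport:
  assumes "\<And>X. X \<in> F \<Longrightarrow> A \<subseteq> X \<Longrightarrow> X \<subseteq> B \<Longrightarrow> f X \<in> G"
    and "\<And>X Y. X \<in> F \<Longrightarrow> Y \<in> F \<Longrightarrow> A \<subseteq> X \<Longrightarrow> X \<subset> Y \<Longrightarrow> Y \<subseteq> B \<Longrightarrow> f X \<subset> f Y"
    and "A' \<in> G" "B' \<in> G" "A' \<subseteq> f A" "f B \<subseteq> B'"
  shows "interval_length F A B \<le> interval_length G A' B'"
  unfolding interval_length_def
proof (rule Sup_subset_mono, safe)
  fix k assume "strict_chain F k A B"
  then have "strict_chain G k A' B'"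
    by (rule strict_chain_transport[where f = f]) (fact assms)+
  then show "\<exists>j. enat k = enat j \<and> strict_chain G j A' B'" by blast
qed

text \<open>
  A sequence with \<open>n\<close> strict steps is a chain. Conversely, a chain whose last inclusion is
  strict has one step more than it promises; both suprema are the same.
\<close>
lemma interval_length_eq_Sup_sequences:
  "interval_length F A B =
    Sup {enat n | n. \<exists>N :: nat \<Rightarrow> 'a set. N 0 = A \<and> N n = B \<and>
      (\<forall>i\<le>n. N i \<in> F) \<and> (\<forall>i<n. N i \<subset> N (Suc i))}"
    (is "_ = Sup {enat n | n. \<exists>N. ?seq n N A}")
proof (rule antisym)
  have ext: "\<exists>n\<ge>k. \<exists>N. ?seq n N A" if "strict_chain F k A B" for k A
    using that
  proof (induction k arbitrary: A)
    case 0
    show ?case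
    proof (cases "A = B")
      case True
      then show ?thesis using 0 by (intro exI[of _ 0]) auto
    next
      case False
      with 0 show ?thesis
        by (intro exI[of _ 1] conjI exI[of _ "\<lambda>i. if i = 0 then A else B"]) auto
    qed
  next
    case (Suc k)
    then obtain M where M: "A \<in> F" "A \<subset> M" "strict_chain F k M B" by auto
    from Suc.IH[OF M(3)] obtain n N where "n \<ge> k" and N: "?seq n N M" by blast
    have "?seq (Suc n) (case_nat A N) A"
      using N M(1,2) by (auto split: nat.split simp: less_Suc_eq_0_disj)
    with \<open>n \<ge> k\<close> show ?case
      by (intro exI[of _ "Suc n"] conjI[of "Suc k \<le> Suc n"] exI[of _ "case_nat A N"]) simp_all
  qed
  show "interval_length F A B \<le> Sup {enat n | n. \<exists>N. ?seq n N A}"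
    unfolding interval_length_def
  proof (rule Sup_mono)
    fix x assume "x \<in> {enat k | k. strict_chain F k A B}"
    then obtain k where k: "x = enat k" "strict_chain F k A B" by blast
    from ext[OF k(2)] obtain n where n: "n \<ge> k" "\<exists>N. ?seq n N A" by blast
    show "\<exists>y\<in>{enat n | n. \<exists>N. ?seq n N A}. x \<le> y"
    proof (rule bexI[of _ "enat n"])
      show "x \<le> enat n" using n(1) k(1) by simp
      show "enat n \<in> {enat n | n. \<exists>N. ?seq n N A}" using n(2) by blast
    qed
  qed
  have "strict_chain F n A B" if "?seq n N A" for n N A
    using that
  proof (induction n arbitrary: N A)
    case (Suc n)
    have "strict_chain F n (N 1) B"
      by (rule Suc.IH[of "\<lambda>i. N (Suc i)"]) (use Suc.prems in auto)
    moreover have "\<forall>i\<le>Suc n. N i \<in> F" "\<forall>i<Suc n. N i \<subset> N (Suc i)" "A = N 0"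
      using Suc.prems by blast+
    then have "A \<in> F" "N 1 \<in> F" "A \<subset> N 1"
      by (metis One_nat_def Suc_le_mono le0 zero_less_Suc)+
    ultimately show ?case by auto
  qed auto
  then have "enat n \<le> interval_length F A B" if "\<exists>N. ?seq n N A" for n
    using that unfolding interval_length_def by (intro Sup_upper CollectI exI[of _ n]) blast
  then show "Sup {enat n | n. \<exists>N. ?seq n N A} \<le> interval_length F A B"
    by (intro Sup_least) blast
qed

lemma module_length_eq_interval_length:
  "module_length R M = interval_length {N. submodule N R M} {\<zero>\<^bsub>M\<^esub>} (carrier M)"
  unfolding module_length_def interval_length_eq_Sup_sequences by simp

lemma enat_le_add_iff:
  "enat k \<le> x + y \<longleftrightarrow> (\<exists>i j. i + j = k \<and> enat i \<le> x \<and> enat j \<le> y)"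
proof
  assume le: "enat k \<le> x + y"
  show "\<exists>i j. i + j = k \<and> enat i \<le> x \<and> enat j \<le> y"
  proof (cases x)
    case (enat p)
    with le have "enat (k - min k p) \<le> y" by (cases y) auto
    with enat show ?thesis
      by (intro exI[of _ "min k p"] exI[of _ "k - min k p"]) simp
  next
    case infinity
    then show ?thesis by (intro exI[of _ k] exI[of _ 0]) (auto simp: zero_enat_def[symmetric])
  qed
next
  assume "\<exists>i j. i + j = k \<and> enat i \<le> x \<and> enat j \<le> y"
  then show "enat k \<le> x + y" by (metis add_mono plus_enat_simps(1))
qed

text \<open>
  Lengths may be infinite, so they are compared through the finite chains that they bound. In this
  way additivity needs no case distinction.
\<close>
lemma enat_eqI:
  assumes "\<And>k. enat k \<le> x \<longleftrightarrow> enat k \<le> y"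
  shows "x = (y :: enat)"
proof (rule antisym)
  have *: "u \<le> v" if that: "\<And>k. enat k \<le> u \<Longrightarrow> enat k \<le> v" for u v :: enat
  proof (cases v)
    case (enat q)
    then have "\<not> enat (Suc q) \<le> u" using that[of "Suc q"] by auto
    then have "u \<le> enat q" by (cases u) auto
    with enat show ?thesis by simp
  qed simp
  show "x \<le> y" "y \<le> x" using assms by (auto intro: *)
qed

section \<open>Lengths of intervals of ideals\<close>

context cring
begin

lemma idealI_cring:
  assumes "X \<subseteq> carrier R" "\<zero> \<in> X"
    and add: "\<And>x y. x \<in> X \<Longrightarrow> y \<in> X \<Longrightarrow> x \<oplus> y \<in> X"
    and mult: "\<And>r x. r \<in> carrier R \<Longrightarrow> x \<in> X \<Longrightarrow> r \<otimes> x \<in> X"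
  shows "ideal X R"
proof (rule idealI[OF ring_axioms])
  have "\<ominus> x \<in> X" if "x \<in> X" for x
    using mult[of "\<ominus> \<one>" x] that assms(1) l_minus[of \<one> x] by auto
  then show "subgroup X (add_monoid R)"
    using assms by (intro add.subgroupI) (auto simp: a_inv_def)
  show "x \<otimes> y \<in> X" "y \<otimes> x \<in> X" if "y \<in> X" "x \<in> carrier R" for x y
    using mult[OF that(2,1)] that assms(1) m_comm[of y x] by auto
qed

lemma ideal_simps:
  assumes "ideal X R"
  shows "x \<in> X \<Longrightarrow> x \<in> carrier R" "\<zero> \<in> X"
    "x \<in> X \<Longrightarrow> y \<in> X \<Longrightarrow> x \<oplus> y \<in> X"
    "x \<in> X \<Longrightarrow> y \<in> X \<Longrightarrow> x \<ominus> y \<in> X"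
    "x \<in> X \<Longrightarrow> \<ominus> x \<in> X"
    "r \<in> carrier R \<Longrightarrow> x \<in> X \<Longrightarrow> r \<otimes> x \<in> X"
proof -
  interpret ideal X R by fact
  show "x \<in> X \<Longrightarrow> x \<in> carrier R" "\<zero> \<in> X" "x \<in> X \<Longrightarrow> y \<in> X \<Longrightarrow> x \<oplus> y \<in> X"
    "x \<in> X \<Longrightarrow> \<ominus> x \<in> X" "r \<in> carrier R \<Longrightarrow> x \<in> X \<Longrightarrow> r \<otimes> x \<in> X"
    by (auto intro: I_l_closed)
  then show "x \<in> X \<Longrightarrow> y \<in> X \<Longrightarrow> x \<ominus> y \<in> X"
    by (simp add: a_minus_def)
qed

lemma mem_set_add_iff: "x \<in> A <+> B \<longleftrightarrow> (\<exists>u\<in>A. \<exists>v\<in>B. x = u \<oplus> v)"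
  by (auto simp: set_add_def')

lemma subset_set_add:
  assumes "ideal A R" "ideal B R"
  shows "A \<subseteq> A <+> B" "B \<subseteq> A <+> B"
proof -
  have "x = x \<oplus> \<zero>" if "x \<in> A" for x using ideal_simps(1)[OF assms(1) that] by simp
  then show "A \<subseteq> A <+> B"
    using ideal_simps(2)[OF assms(2)] unfolding subset_iff mem_set_add_iff by blast
  have "x = \<zero> \<oplus> x" if "x \<in> B" for x using ideal_simps(1)[OF assms(2) that] by simp
  then show "B \<subseteq> A <+> B"
    using ideal_simps(2)[OF assms(1)] unfolding subset_iff mem_set_add_iff by blast
qed

lemma set_add_subset:
  assumes "ideal C R" "A \<subseteq> C" "B \<subseteq> C"
  shows "A <+> B \<subseteq> C"
  using assms(2,3) ideal_simps(3)[OF assms(1)] unfolding subset_iff mem_set_add_iff by blast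

abbreviation ideal_length :: "'a set \<Rightarrow> 'a set \<Rightarrow> enat" where
  "ideal_length \<equiv> interval_length {X. ideal X R}"

abbreviation ideal_chain :: "nat \<Rightarrow> 'a set \<Rightarrow> 'a set \<Rightarrow> bool" where
  "ideal_chain \<equiv> strict_chain {X. ideal X R}"

text \<open>
  The diamond isomorphism: intersecting with \<open>B\<close> is strictly monotone between \<open>A\<close> and \<open>A + B\<close>,
  since the difference of an element of \<open>A + B\<close> and its \<open>A\<close>-part lies in \<open>B\<close>.
\<close>
lemma ideal_chain_meet:
  assumes "ideal_chain k A (A <+> B)" "ideal B R"
  shows "ideal_chain k (A \<inter> B) B"
proof (rule strict_chain_transport[OF assms(1), where f = "\<lambda>X. X \<inter> B"])
  have A: "ideal A R" using strict_chainD(1)[OF assms(1)] by simp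
  show "A \<inter> B \<in> {X. ideal X R}" using A assms(2) i_intersect by simp
  show "X \<inter> B \<subset> Y \<inter> B"
    if "X \<in> {X. ideal X R}" "Y \<in> {X. ideal X R}" "A \<subseteq> X" "X \<subset> Y" "Y \<subseteq> A <+> B" for X Y
  proof -
    from that obtain y where y: "y \<in> Y" "y \<notin> X" by blast
    then have "y \<in> A <+> B" using that(5) by blast
    then obtain u v where uv: "u \<in> A" "v \<in> B" "y = u \<oplus> v"
      unfolding mem_set_add_iff by blast
    have carr: "u \<in> carrier R" "v \<in> carrier R"
      using uv ideal_simps(1) A assms(2) by auto
    have "v = y \<ominus> u" unfolding uv(3) using carr by algebra
    moreover have "u \<in> Y" using uv(1) that by blast
    ultimately have "v \<in> Y" using ideal_simps(4)[of Y y u] that y by simp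
    moreover have "v \<notin> X"
      using y(2) uv that ideal_simps(3)[of X u v] by auto
    ultimately show ?thesis using uv(2) that(4) by blast
  qed
qed (use assms(2) i_intersect in auto)

text \<open>
  The first step \<open>A \<subset> M\<close> of a chain is strict in one of the two parts: either \<open>M\<close> meets \<open>B\<close> in
  more than \<open>A\<close>, or \<open>M + B\<close> is larger than \<open>B\<close>. The rest of the chain is split at \<open>M + B\<close>, and
  its lower part is moved from the interval below \<open>M + B\<close> to the one below \<open>B\<close> along the diamond.
\<close>
lemma ideal_chain_split:
  assumes "ideal_chain k A C" "ideal B R" "A \<subseteq> B" "B \<subseteq> C"
  shows "\<exists>i j. i + j = k \<and> ideal_chain i A B \<and> ideal_chain j B C"
  using assms
proof (induction k arbitrary: A B)
  case 0
  then show ?case by auto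
next
  case (Suc k)
  then obtain M where M: "ideal A R" "ideal M R" "A \<subset> M" "ideal_chain k M C" by auto
  note MC = strict_chainD[OF M(4)]
  have MB: "ideal (M <+> B) R" "M \<subseteq> M <+> B" "B \<subseteq> M <+> B" "M <+> B \<subseteq> C"
    using add_ideals[OF M(2) Suc.prems(2)] subset_set_add[OF M(2) Suc.prems(2)]
      set_add_subset[of C M B] MC Suc.prems by auto
  from Suc.IH[OF M(4) MB(1,2,4)] obtain i j where ij: "i + j = k"
    and i: "ideal_chain i M (M <+> B)" and j: "ideal_chain j (M <+> B) C" by blast
  have i': "ideal_chain i (M \<inter> B) B"
    by (rule ideal_chain_meet[OF i Suc.prems(2)])
  show ?case
  proof (cases "M \<inter> B = A")
    case False
    then have "A \<subset> M \<inter> B" using M(3) Suc.prems(3) by blast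
    with i' have "ideal_chain (Suc i) A B"
      using M(1) strict_chainD(1)[OF i'] by auto
    moreover have "ideal_chain j B C"
      using strict_chain_mono[OF j _ _ MB(3)] Suc.prems(2) MC by auto
    ultimately show ?thesis using ij by (metis add_Suc)
  next
    case True
    then have "B \<subset> M <+> B" using MB(2,3) M(3) by blast
    then have "ideal_chain (Suc j) B C" using j MB(1) Suc.prems(2) by auto
    moreover have "ideal_chain i A B" using i' True by simp
    ultimately show ?thesis using ij by (metis add_Suc_right)
  qed
qed

lemma ideal_length_additive:
  assumes "ideal A R" "ideal B R" "ideal C R" "A \<subseteq> B" "B \<subseteq> C"
  shows "ideal_length A C = ideal_length A B + ideal_length B C"
proof (rule enat_eqI)
  fix k
  have "enat k \<le> ideal_length A C \<longleftrightarrow> ideal_chain k A C"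
    using strict_chain_iff_interval_length[of A "{X. ideal X R}" C] assms by auto
  also have "\<dots> \<longleftrightarrow> (\<exists>i j. i + j = k \<and> ideal_chain i A B \<and> ideal_chain j B C)"
    using ideal_chain_split[OF _ assms(2,4,5)] strict_chain_append by blast
  also have "\<dots> \<longleftrightarrow> enat k \<le> ideal_length A B + ideal_length B C"
    using strict_chain_iff_interval_length[of A "{X. ideal X R}" B]
      strict_chain_iff_interval_length[of B "{X. ideal X R}" C] assms
    by (simp add: enat_le_add_iff)
  finally show "enat k \<le> ideal_length A C \<longleftrightarrow>
    enat k \<le> ideal_length A B + ideal_length B C" .
qed

text \<open>
  The hypothesis \<open>A \<inter> B' \<subseteq> A'\<close> says that the map \<open>B'/A' \<rightarrow> B/A\<close> induced by the inclusion is
  injective, so \<open>B'/A'\<close> is a submodule of \<open>B/A\<close>.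
\<close>
lemma ideal_length_le_of_injective:
  assumes "ideal A R" "ideal B R" "ideal A' R" "ideal B' R"
    and "A \<subseteq> B" "A' \<subseteq> A" "A' \<subseteq> B'" "B' \<subseteq> B" "A \<inter> B' \<subseteq> A'"
  shows "ideal_length A' B' \<le> ideal_length A B"
proof (rule interval_length_transport[where f = "\<lambda>X. X <+> A"])
  show "X <+> A \<in> {X. ideal X R}" if "X \<in> {X. ideal X R}" for X
    using that add_ideals assms(1) by simp
  show "A \<subseteq> A' <+> A" using subset_set_add assms by blast
  show "B' <+> A \<subseteq> B" using set_add_subset assms by blast
  show "X <+> A \<subset> Y <+> A"
    if XY: "X \<in> {X. ideal X R}" "Y \<in> {X. ideal X R}" "A' \<subseteq> X" "X \<subset> Y" "Y \<subseteq> B'" for X Y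
  proof -
    have X: "ideal X R" and Y: "ideal Y R" using XY by auto
    from XY obtain y where y: "y \<in> Y" "y \<notin> X" by blast
    have "y \<notin> X <+> A"
    proof
      assume "y \<in> X <+> A"
      then obtain x v where xv: "x \<in> X" "v \<in> A" "y = x \<oplus> v"
        unfolding mem_set_add_iff by blast
      have "x \<in> carrier R" "v \<in> carrier R"
        using xv ideal_simps(1) X assms(1) by auto
      then have "v = y \<ominus> x" unfolding xv(3) by algebra
      then have "v \<in> Y" using ideal_simps(4)[OF Y, of y x] xv(1) XY(4) y(1) by auto
      then have "v \<in> X" using xv(2) assms(9) XY by blast
      then show False using y(2) xv ideal_simps(3)[OF X] by auto
    qed
    moreover have "y \<in> Y <+> A" using subset_set_add(1)[OF Y assms(1)] y(1) by blast
    moreover have "X <+> A \<subseteq> Y <+> A" using XY(4) unfolding subset_iff mem_set_add_iff by blast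
    ultimately show ?thesis by blast
  qed
qed (use assms in auto)

lemma ideal_mult_image:
  assumes "ideal X R" "a \<in> carrier R"
  shows "ideal ((\<lambda>x. a \<otimes> x) ` X) R"
proof (rule idealI_cring)
  note X = ideal_simps[OF assms(1)]
  show "(\<lambda>x. a \<otimes> x) ` X \<subseteq> carrier R" using X(1) assms(2) by auto
  show "\<zero> \<in> (\<lambda>x. a \<otimes> x) ` X" using X(2) assms(2) r_null by (metis image_eqI)
  show "u \<oplus> v \<in> (\<lambda>x. a \<otimes> x) ` X"
    if "u \<in> (\<lambda>x. a \<otimes> x) ` X" "v \<in> (\<lambda>x. a \<otimes> x) ` X" for u v
    using that X(1,3) assms(2) by (auto simp: r_distr[symmetric])
  show "r \<otimes> u \<in> (\<lambda>x. a \<otimes> x) ` X"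
    if "r \<in> carrier R" "u \<in> (\<lambda>x. a \<otimes> x) ` X" for r u
    using that X(1,6) assms(2) by (auto simp: m_lcomm[of r a])
qed

lemma ideal_mult_preimage:
  assumes "ideal X R" "ideal B R" "a \<in> carrier R"
  shows "ideal {y \<in> B. a \<otimes> y \<in> X} R"
  by (rule idealI_cring)
    (use ideal_simps[OF assms(1)] ideal_simps[OF assms(2)] assms(3) in
      \<open>auto simp: r_distr m_lcomm[of a]\<close>)

text \<open>
  Multiplication by \<open>a\<close> maps \<open>B/A\<close> onto \<open>aB/aA\<close> with kernel \<open>K/A\<close>.
\<close>
lemma ideal_length_mult_image:
  assumes "ideal A R" "ideal B R" "A \<subseteq> B" "a \<in> carrier R"
  defines "K \<equiv> {y \<in> B. a \<otimes> y \<in> (\<lambda>x. a \<otimes> x) ` A}"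
  shows "ideal_length ((\<lambda>x. a \<otimes> x) ` A) ((\<lambda>x. a \<otimes> x) ` B) = ideal_length K B"
proof (rule antisym)
  note B = ideal_simps[OF assms(2)]
  have K: "ideal K R" unfolding K_def
    by (rule ideal_mult_preimage[OF ideal_mult_image[OF assms(1,4)] assms(2,4)])
  show "ideal_length ((\<lambda>x. a \<otimes> x) ` A) ((\<lambda>x. a \<otimes> x) ` B) \<le> ideal_length K B"
  proof (rule interval_length_transport[where f = "\<lambda>X. {y \<in> B. a \<otimes> y \<in> X}"])
    show "{y \<in> B. a \<otimes> y \<in> X} \<subset> {y \<in> B. a \<otimes> y \<in> Y}"
      if "X \<subset> Y" "Y \<subseteq> (\<lambda>x. a \<otimes> x) ` B" for X Y
      using that by blast
  qed (use ideal_mult_preimage assms(2,4) K in \<open>auto simp: K_def\<close>)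
  show "ideal_length K B \<le> ideal_length ((\<lambda>x. a \<otimes> x) ` A) ((\<lambda>x. a \<otimes> x) ` B)"
  proof (rule interval_length_transport[where f = "\<lambda>X. (\<lambda>x. a \<otimes> x) ` X"])
    show "(\<lambda>x. a \<otimes> x) ` A \<subseteq> (\<lambda>x. a \<otimes> x) ` K"
      using assms(3) by (auto simp: K_def)
    show "(\<lambda>x. a \<otimes> x) ` X \<subset> (\<lambda>x. a \<otimes> x) ` Y"
      if XY: "X \<in> {X. ideal X R}" "Y \<in> {X. ideal X R}" "K \<subseteq> X" "X \<subset> Y" "Y \<subseteq> B" for X Y
    proof -
      from XY obtain y where y: "y \<in> Y" "y \<notin> X" by blast
      have "a \<otimes> y \<notin> (\<lambda>x. a \<otimes> x) ` X"
      proof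
        assume "a \<otimes> y \<in> (\<lambda>x. a \<otimes> x) ` X"
        then obtain x where x: "x \<in> X" "a \<otimes> y = a \<otimes> x" by auto
        have B': "x \<in> B" "y \<in> B" using x y XY by auto
        then have carr: "x \<in> carrier R" "y \<in> carrier R" using B(1) by auto
        have "a \<otimes> (y \<ominus> x) = a \<otimes> y \<ominus> a \<otimes> x" using carr assms(4) by algebra
        also have "\<dots> = a \<otimes> \<zero>" using x(2) carr assms(4) by (simp add: a_minus_def r_neg)
        finally have "y \<ominus> x \<in> K"
          using B(4) B' ideal_simps(2)[OF assms(1)] by (auto simp: K_def)
        then have "x \<oplus> (y \<ominus> x) \<in> X" using XY x(1) ideal_simps(3) by blast
        moreover have "x \<oplus> (y \<ominus> x) = y" using carr by algebra
        ultimately show False using y(2) by simp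
      qed
      then show ?thesis using XY(4) y(1) by blast
    qed
  qed (use ideal_mult_image assms(1,2,4) in auto)
qed

section \<open>Saturation with respect to an ideal\<close>

text \<open>
  The colon ideal \<open>X : m\<^sup>\<infinity>\<close>, so that \<open>saturation m X\<close> modulo \<open>X\<close> is the local cohomology
  of \<open>R/X\<close>.
\<close>
definition saturation :: "'a set \<Rightarrow> 'a set \<Rightarrow> 'a set" where
  "saturation m X = {x \<in> carrier R. \<exists>s>0. \<forall>r\<in>ideal_power R m s. r \<otimes> x \<in> X}"

lemma ideal_power_0: "ideal_power R m 0 = carrier R"
  by (simp add: nat_pow_def ideals_set_def)

lemma ideal_power_Suc: "ideal_power R m (Suc s) = ideal_power R m s \<cdot> m"
  by (simp add: nat_pow_def ideals_set_def)

lemma ideal_power_antimono: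
  assumes "ideal m R" "s \<le> t"
  shows "ideal_power R m t \<subseteq> ideal_power R m s"
  using assms(2)
proof (induction t rule: dec_induct)
  case (step t)
  have "ideal_power R m (Suc t) \<subseteq> ideal_power R m t"
    unfolding ideal_power_Suc
    using ideal_prod_inter[OF ideal_power_ideal[OF assms(1)] assms(1), of t] by blast
  with step.IH show ?case by blast
qed simp

lemma ideal_saturation:
  assumes "ideal m R" "ideal X R"
  shows "ideal (saturation m X) R"
proof (rule idealI_cring)
  note X = ideal_simps[OF assms(2)]
  have pow: "r \<in> carrier R" if "r \<in> ideal_power R m s" for r s
    using ideal.Icarr[OF ideal_power_ideal[OF assms(1)] that] .
  show "saturation m X \<subseteq> carrier R" by (auto simp: saturation_def)
  show "\<zero> \<in> saturation m X" using pow X(2) by (auto simp: saturation_def)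
  show "x \<oplus> y \<in> saturation m X" if xy: "x \<in> saturation m X" "y \<in> saturation m X" for x y
  proof -
    from xy obtain s t where s: "s > 0" "\<forall>r\<in>ideal_power R m s. r \<otimes> x \<in> X"
      and t: "t > 0" "\<forall>r\<in>ideal_power R m t. r \<otimes> y \<in> X"
      and carr: "x \<in> carrier R" "y \<in> carrier R"
      by (auto simp: saturation_def)
    have "r \<otimes> (x \<oplus> y) \<in> X" if "r \<in> ideal_power R m (max s t)" for r
    proof -
      have "r \<in> ideal_power R m s" "r \<in> ideal_power R m t"
        using ideal_power_antimono[OF assms(1), of s "max s t"]
          ideal_power_antimono[OF assms(1), of t "max s t"] that by auto
      then show ?thesis using s t X(3) pow[OF that] carr by (simp add: r_distr)
    qed
    then show ?thesis
      using s(1) carr by (auto simp: saturation_def intro!: exI[of _ "max s t"])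
  qed
  show "r \<otimes> x \<in> saturation m X" if "r \<in> carrier R" "x \<in> saturation m X" for r x
  proof -
    from that obtain s where x: "x \<in> carrier R" "s > 0" "\<forall>q\<in>ideal_power R m s. q \<otimes> x \<in> X"
      by (auto simp: saturation_def)
    have "q \<otimes> (r \<otimes> x) \<in> X" if q: "q \<in> ideal_power R m s" for q
      using X(6)[OF \<open>r \<in> carrier R\<close>] x q m_lcomm[OF pow[OF q] \<open>r \<in> carrier R\<close>] by simp
    then show ?thesis using x \<open>r \<in> carrier R\<close> unfolding saturation_def by blast
  qed
qed

lemma subset_saturation:
  assumes "ideal m R" "ideal X R"
  shows "X \<subseteq> saturation m X"
proof
  fix x assume x: "x \<in> X"
  have "\<forall>r\<in>ideal_power R m 1. r \<otimes> x \<in> X"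
    using ideal_simps(6)[OF assms(2) _ x] ideal_simps(1)[OF ideal_power_ideal[OF assms(1)]]
    by blast
  then show "x \<in> saturation m X"
    using ideal_simps(1)[OF assms(2) x] zero_less_one unfolding saturation_def by blast
qed

lemma saturation_mono: "X \<subseteq> Y \<Longrightarrow> saturation m X \<subseteq> saturation m Y"
  unfolding saturation_def by blast

lemma mult_image_saturation_subset:
  assumes m: "ideal m R" and a: "a \<in> carrier R"
  shows "(\<lambda>x. a \<otimes> x) ` saturation m X \<subseteq> saturation m ((\<lambda>x. a \<otimes> x) ` X)"
proof
  fix x assume "x \<in> (\<lambda>x. a \<otimes> x) ` saturation m X"
  then obtain y where y: "y \<in> saturation m X" "x = a \<otimes> y" by blast
  then obtain s where s: "s > 0" "\<forall>r\<in>ideal_power R m s. r \<otimes> y \<in> X" and yc: "y \<in> carrier R"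
    by (auto simp: saturation_def)
  have "r \<otimes> x \<in> (\<lambda>x. a \<otimes> x) ` X" if r: "r \<in> ideal_power R m s" for r
  proof -
    have "r \<otimes> x = a \<otimes> (r \<otimes> y)"
      unfolding y(2) using ideal_simps(1)[OF ideal_power_ideal[OF m] r] yc a m_lcomm by simp
    then show ?thesis using s(2) r by blast
  qed
  moreover have "x \<in> carrier R" unfolding y(2) using yc a by simp
  ultimately show "x \<in> saturation m ((\<lambda>x. a \<otimes> x) ` X)"
    using s(1) unfolding saturation_def by blast
qed

text \<open>
  A cancellation law for elements passes to saturations: apply it to the multiples \<open>ry\<close>
  with \<open>r\<close> in a high power of \<open>m\<close>.
\<close>
lemma saturation_mult_cancel:
  assumes m: "ideal m R" and a: "a \<in> carrier R"
    and cancel: "\<And>z. z \<in> X \<Longrightarrow> a \<otimes> z \<in> Y \<Longrightarrow> z \<in> Z"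
    and y: "y \<in> saturation m X" "a \<otimes> y \<in> saturation m Y"
  shows "y \<in> saturation m Z"
proof -
  from y(1) obtain s where s: "s > 0" "\<forall>r\<in>ideal_power R m s. r \<otimes> y \<in> X"
    and yc: "y \<in> carrier R"
    by (auto simp: saturation_def)
  from y(2) obtain t where t: "\<forall>r\<in>ideal_power R m t. r \<otimes> (a \<otimes> y) \<in> Y"
    by (auto simp: saturation_def)
  have "r \<otimes> y \<in> Z" if r: "r \<in> ideal_power R m (max s t)" for r
  proof (rule cancel)
    have rst: "r \<in> ideal_power R m s" "r \<in> ideal_power R m t"
      using ideal_power_antimono[OF m, of s "max s t"]
        ideal_power_antimono[OF m, of t "max s t"] r by auto
    show "r \<otimes> y \<in> X" using s(2) rst(1) by blast
    have "a \<otimes> (r \<otimes> y) = r \<otimes> (a \<otimes> y)"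
      using ideal_simps(1)[OF ideal_power_ideal[OF m] r] yc a m_lcomm by simp
    then show "a \<otimes> (r \<otimes> y) \<in> Y" using t rst(2) by simp
  qed
  moreover have "max s t > 0" using s(1) by simp
  ultimately show ?thesis using yc unfolding saturation_def by blast
qed

text \<open>
  Take \<open>y \<in> Y - X\<close> and the least \<open>s\<close> with \<open>m\<^sup>s y \<subseteq> X\<close>. Some multiple of \<open>y\<close> by an element
  of \<open>m\<^sup>s\<^sup>-\<^sup>1\<close> lies outside \<open>X\<close>, and \<open>m\<close> multiplies it into \<open>X\<close>.
\<close>
lemma socle_element:
  assumes m: "ideal m R" and X: "ideal X R" and Y: "ideal Y R"
    and sub: "X \<subset> Y" "Y \<subseteq> saturation m X"
  shows "\<exists>x\<in>Y - X. \<forall>r\<in>m. r \<otimes> x \<in> X"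
proof -
  from sub obtain y where y: "y \<in> Y" "y \<notin> X" by blast
  then have ycarr: "y \<in> carrier R" using ideal_simps(1)[OF Y] by simp
  define s where "s = (LEAST s. \<forall>r\<in>ideal_power R m s. r \<otimes> y \<in> X)"
  have "\<exists>s. \<forall>r\<in>ideal_power R m s. r \<otimes> y \<in> X"
    using y(1) sub(2) by (auto simp: saturation_def)
  then have s: "\<forall>r\<in>ideal_power R m s. r \<otimes> y \<in> X"
    unfolding s_def by (rule LeastI_ex)
  have "s \<noteq> 0"
  proof
    assume "s = 0"
    then have "\<one> \<otimes> y \<in> X" using s ideal_power_0 by blast
    then show False using y(2) ycarr by simp
  qed
  then obtain t where t: "s = Suc t" using not0_implies_Suc by blast
  then have "\<not> (\<forall>r\<in>ideal_power R m t. r \<otimes> y \<in> X)"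
    using not_less_Least[of t "\<lambda>s. \<forall>r\<in>ideal_power R m s. r \<otimes> y \<in> X"]
    unfolding s_def by simp
  then obtain q where q: "q \<in> ideal_power R m t" "q \<otimes> y \<notin> X" by blast
  have qcarr: "q \<in> carrier R" using ideal_simps(1)[OF ideal_power_ideal[OF m] q(1)] .
  have "r \<otimes> (q \<otimes> y) \<in> X" if r: "r \<in> m" for r
  proof -
    have "q \<otimes> r \<in> ideal_power R m s"
      unfolding t ideal_power_Suc by (rule ideal_prod.prod[OF q(1) r])
    then have "(q \<otimes> r) \<otimes> y \<in> X" using s by blast
    also have "(q \<otimes> r) \<otimes> y = r \<otimes> (q \<otimes> y)"
      using ideal_simps(1)[OF m r] qcarr ycarr by algebra
    finally show ?thesis .
  qed
  moreover have "q \<otimes> y \<in> Y" using ideal_simps(6)[OF Y qcarr y(1)] .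
  ultimately show ?thesis using q(2) by blast
qed

text \<open>
  The quotient \<open>(X + xR)/X\<close> is a homomorphic image of the field \<open>R/m\<close>. In terms of elements: an
  ideal strictly above \<open>X\<close> contains some \<open>u + rx\<close> with \<open>u \<in> X\<close> and \<open>r \<notin> m\<close>, and \<open>r\<close> is a unit
  modulo \<open>m\<close>, so the ideal contains \<open>x\<close>.
\<close>
lemma ideal_length_insert_socle_element:
  assumes m: "maximalideal m R" and X: "ideal X R" and x: "x \<in> carrier R"
    and soc: "\<forall>r\<in>m. r \<otimes> x \<in> X"
  shows "ideal_length X (X <+> PIdl x) \<le> 1"
proof -
  have mid: "ideal m R" using m maximalideal.axioms(1) by blast
  have full: "x \<in> N" if N: "ideal N R" "X \<subset> N" "N \<subseteq> X <+> PIdl x" for N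
  proof -
    from N obtain n where n: "n \<in> N" "n \<notin> X" by blast
    then obtain u r where u: "u \<in> X" and r: "r \<in> carrier R" and nu: "n = u \<oplus> r \<otimes> x"
      using N(3) unfolding subset_iff mem_set_add_iff cgenideal_def by blast
    have ucarr: "u \<in> carrier R" using ideal_simps(1)[OF X u] .
    have "r \<otimes> x = n \<ominus> u" unfolding nu using ucarr r x by algebra
    then have rx: "r \<otimes> x \<in> N" using ideal_simps(4)[OF N(1), of n u] n(1) u N(2) by auto
    have "r \<notin> m" using n(2) nu u soc ideal_simps(3)[OF X] by auto
    have "m <+> PIdl r = carrier R"
    proof -
      have "ideal (m <+> PIdl r) R" using add_ideals[OF mid cgenideal_ideal[OF r]] .
      moreover have "m \<subseteq> m <+> PIdl r" "r \<in> m <+> PIdl r"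
        using subset_set_add[OF mid cgenideal_ideal[OF r]] cgenideal_self[OF r] by auto
      ultimately show ?thesis
        using maximalideal.I_maximal[OF m] \<open>r \<notin> m\<close> ideal.Icarr
        by (metis subsetI)
    qed
    then have "\<one> \<in> m <+> PIdl r" by simp
    then obtain v b where v: "v \<in> m" and b: "b \<in> carrier R" and one: "\<one> = v \<oplus> b \<otimes> r"
      unfolding mem_set_add_iff cgenideal_def by blast
    have vcarr: "v \<in> carrier R" using ideal_simps(1)[OF mid v] .
    have "x = \<one> \<otimes> x" using x by simp
    also have "\<dots> = v \<otimes> x \<oplus> b \<otimes> (r \<otimes> x)"
      unfolding one using vcarr b r x by algebra
    also have "\<dots> \<in> N"
      using soc v N(1,2) ideal_simps(6)[OF N(1) b rx] ideal_simps(3)[OF N(1)] by blast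
    finally show ?thesis .
  qed
  have "k \<le> 1" if k: "ideal_chain k X (X <+> PIdl x)" for k
  proof (rule ccontr)
    assume "\<not> k \<le> 1"
    then have "ideal_chain 2 X (X <+> PIdl x)" using strict_chain_less[OF k] by simp
    then obtain M N where MN: "ideal M R" "X \<subset> M" "M \<subset> N" "N \<subseteq> X <+> PIdl x"
      by (auto simp: numeral_2_eq_2)
    have "x \<in> M" using full MN by blast
    then have "X <+> PIdl x \<subseteq> M"
      using set_add_subset[OF MN(1)] MN(2) cgenideal_minimal[OF MN(1)] by blast
    then show False using MN by blast
  qed
  then show ?thesis
    unfolding interval_length_def by (intro Sup_least) (auto simp: one_enat_def)
qed

end

text \<open>
  In a Noetherian ring the union of a nonempty chain of ideals belongs to the chain, so Zorn's lemma applies to every nonempty set of ideals.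
\<close>
lemma (in noetherian_ring) ex_maximal_ideal_in:
  assumes "S \<noteq> {}" "\<And>X. X \<in> S \<Longrightarrow> ideal X R"
  shows "\<exists>M\<in>S. \<forall>X\<in>S. M \<subseteq> X \<longrightarrow> X = M"
proof (rule subset_Zorn_nonempty[OF assms(1)])
  fix C assume C: "C \<noteq> {}" "subset.chain S C"
  have "subset.chain {I. ideal I R} C"
    using C(2) assms(2) unfolding pred_on.chain_def by blast
  then have "\<Union>C \<in> C" using ideal_chain_is_trivial[OF C(1)] by blast
  then show "\<Union>C \<in> S" using C(2) unfolding pred_on.chain_def by blast
qed

text \<open>
  Noetherian induction. Let \<open>M\<close> be maximal among the ideals \<open>X\<close> with \<open>Y\<close> in the saturation of \<open>X\<close>
  and \<open>\<ell>(Y/X)\<close> infinite. Adjoining a socle element of \<open>Y/M\<close> to \<open>M\<close> costs at most one step, so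
  the larger ideal is again a counterexample, against the choice of \<open>M\<close>.
\<close>
lemma (in cring) finite_ideal_length_saturation:
  assumes "noetherian_ring R" and m: "maximalideal m R"
    and X: "ideal X R" and Y: "ideal Y R" and sub: "X \<subseteq> Y" "Y \<subseteq> saturation m X"
  shows "ideal_length X Y \<noteq> \<infinity>"
proof (rule ccontr)
  interpret noetherian_ring R by fact
  have mid: "ideal m R" using m maximalideal.axioms(1) by blast
  define S where
    "S = {X. ideal X R \<and> X \<subseteq> Y \<and> Y \<subseteq> saturation m X \<and> ideal_length X Y = \<infinity>}"
  assume "\<not> ideal_length X Y \<noteq> \<infinity>"
  then have "S \<noteq> {}" using X sub by (auto simp: S_def)
  then have "\<exists>M\<in>S. \<forall>X\<in>S. M \<subseteq> X \<longrightarrow> X = M"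
    by (rule ex_maximal_ideal_in) (simp add: S_def)
  then obtain M where M: "ideal M R" "M \<subseteq> Y" "Y \<subseteq> saturation m M" "ideal_length M Y = \<infinity>"
    and max: "\<And>X. X \<in> S \<Longrightarrow> M \<subseteq> X \<Longrightarrow> X = M"
    by (auto simp: S_def)
  have "M \<noteq> Y"
  proof
    assume "M = Y"
    then have "\<not> ideal_chain 1 M Y"
      using strict_chainD(3) by (auto simp: one_enat_def)
    then show False
      using strict_chain_iff_interval_length[of M "{X. ideal X R}" Y 1] M Y by auto
  qed
  then have "M \<subset> Y" using M(2) by blast
  from socle_element[OF mid M(1) Y this M(3)]
  obtain x where x: "x \<in> Y" "x \<notin> M" "\<forall>r\<in>m. r \<otimes> x \<in> M" by blast
  have xc: "x \<in> carrier R" using ideal_simps(1)[OF Y x(1)] .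
  define M' where "M' = M <+> PIdl x"
  have M': "ideal M' R" "M \<subseteq> M'" "x \<in> M'"
    using add_ideals[OF M(1) cgenideal_ideal[OF xc]] cgenideal_self[OF xc]
      subset_set_add[OF M(1) cgenideal_ideal[OF xc]] by (auto simp: M'_def)
  have M'Y: "M' \<subseteq> Y"
    unfolding M'_def using set_add_subset[OF Y M(2)] cgenideal_minimal[OF Y x(1)] by blast
  have "ideal_length M M' \<le> 1"
    unfolding M'_def by (rule ideal_length_insert_socle_element[OF m M(1) xc x(3)])
  then have "ideal_length M M' \<noteq> \<infinity>"
    by (cases "ideal_length M M'") (auto simp: one_enat_def)
  moreover have "ideal_length M Y = ideal_length M M' + ideal_length M' Y"
    by (rule ideal_length_additive) (use M M' M'Y Y in auto)
  ultimately have "ideal_length M' Y = \<infinity>" using M(4) by (metis plus_eq_infty_iff_enat)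
  moreover have "Y \<subseteq> saturation m M'" using M(3) saturation_mono[OF M'(2)] by blast
  ultimately have "M' \<in> S" using M' M'Y by (simp add: S_def)
  then show False using max[OF _ M'(2)] M'(3) x(2) by blast
qed

section \<open>The correspondence theorem for the local cohomology of a quotient\<close>

context cring
begin

text \<open>
  Submodules of the local cohomology of \<open>R/I\<close> correspond to the ideals between \<open>I\<close> and its
  saturation. Taking images and preimages under the projection is strictly monotone in both
  directions, which gives the two inequalities.
\<close>
lemma length_local_cohomology0_quot:
  assumes I: "ideal I R" and m: "ideal m R"
  shows "module_length R (local_cohomology0 R m (quot_module R I)) =
    ideal_length I (saturation m I)"
proof -
  interpret I: ideal I R by (rule I)
  let ?L = "local_cohomology0 R m (quot_module R I)"
  let ?S = "saturation m I"
  have S: "ideal ?S R" by (rule ideal_saturation[OF m I])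
  have IS: "I \<subseteq> ?S" by (rule subset_saturation[OF m I])
  have h: "(+>) I \<in> ring_hom R (R Quot I)" by (rule I.rcos_ring_hom)
  have carrL: "carrier ?L = (+>) I ` ?S"
    unfolding carrier_local_cohomology0_quot[OF I m] saturation_def
    by (intro image_cong) auto
  have zeroL: "\<zero>\<^bsub>?L\<^esub> = I +> \<zero>"
    using I.a_rcos_const[OF I.zero_closed] by (simp add: local_cohomology0_def FactRing_def)
  have addL: "(I +> x) \<oplus>\<^bsub>?L\<^esub> (I +> y) = I +> (x \<oplus> y)"
    if "x \<in> carrier R" "y \<in> carrier R" for x y
    using ring_hom_add[OF h that] by (simp add: local_cohomology0_def)
  have smultL: "r \<odot>\<^bsub>?L\<^esub> (I +> x) = I +> (r \<otimes> x)"
    if "x \<in> carrier R" "r \<in> carrier R" for x r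
    using ring_hom_mult[OF h that(2,1)] by (simp add: local_cohomology0_def)
  have coset_eq: "I +> x = I +> y \<longleftrightarrow> x \<ominus> y \<in> I"
    if "x \<in> carrier R" "y \<in> carrier R" for x y
    using quotient_eq_iff_same_a_r_cos[OF I that] by simp
  have coset_mem: "x \<in> X"
    if X: "ideal X R" "I \<subseteq> X" and x: "x \<in> carrier R" "I +> x \<in> (+>) I ` X" for X x
  proof -
    from x obtain y where y: "y \<in> X" "I +> x = I +> y" by blast
    have yc: "y \<in> carrier R" using ideal_simps(1)[OF X(1) y(1)] .
    have "x \<ominus> y \<in> X" using coset_eq[OF x(1) yc] y(2) X(2) by blast
    then have "(x \<ominus> y) \<oplus> y \<in> X" using ideal_simps(3)[OF X(1)] y(1) by blast
    moreover have "(x \<ominus> y) \<oplus> y = x" using x(1) yc by algebra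
    ultimately show ?thesis by simp
  qed
  have submod: "submodule ((+>) I ` X) R ?L" if X: "ideal X R" "I \<subseteq> X" "X \<subseteq> ?S" for X
  proof -
    note Xs = ideal_simps[OF X(1)]
    \<comment> \<open>The inverse is a definite description over the smaller carrier of \<open>?L\<close>, so it has to be
      shown that it agrees with the negative in the quotient ring.\<close>
    have inv: "inv\<^bsub>add_monoid ?L\<^esub> (I +> x) = I +> (\<ominus> x)" if x: "x \<in> X" for x
    proof -
      have xc: "x \<in> carrier R" "\<ominus> x \<in> carrier R" using Xs(1)[OF x] by auto
      have mem: "I +> (\<ominus> x) \<in> carrier ?L" unfolding carrL using Xs(5)[OF x] X(3) by blast
      have 1: "(I +> x) \<oplus>\<^bsub>?L\<^esub> (I +> (\<ominus> x)) = \<zero>\<^bsub>?L\<^esub>"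
        unfolding addL[OF xc] zeroL using r_neg[OF xc(1)] by simp
      have 2: "(I +> (\<ominus> x)) \<oplus>\<^bsub>?L\<^esub> (I +> x) = \<zero>\<^bsub>?L\<^esub>"
        unfolding addL[OF xc(2,1)] zeroL using l_neg[OF xc(1)] by simp
      have 3: "Z = I +> (\<ominus> x)" if Z: "Z \<in> carrier ?L" "(I +> x) \<oplus>\<^bsub>?L\<^esub> Z = \<zero>\<^bsub>?L\<^esub>" for Z
      proof -
        from Z(1) obtain z where z: "z \<in> ?S" "Z = I +> z" unfolding carrL by blast
        have zc: "z \<in> carrier R" using ideal_simps(1)[OF S z(1)] .
        have "I +> (x \<oplus> z) = I +> \<zero>" using Z(2) unfolding z(2) addL[OF xc(1) zc] zeroL .
        then have "(x \<oplus> z) \<ominus> \<zero> \<in> I" using coset_eq xc zc by simp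
        also have "(x \<oplus> z) \<ominus> \<zero> = z \<ominus> (\<ominus> x)" using xc(1) zc by algebra
        finally show ?thesis using coset_eq[OF zc xc(2)] z(2) by simp
      qed
      show ?thesis
        unfolding m_inv_def
      proof (rule the_equality)
        show "I +> (\<ominus> x) \<in> carrier (add_monoid ?L) \<and>
            (I +> x) \<otimes>\<^bsub>add_monoid ?L\<^esub> (I +> (\<ominus> x)) = \<one>\<^bsub>add_monoid ?L\<^esub> \<and>
            (I +> (\<ominus> x)) \<otimes>\<^bsub>add_monoid ?L\<^esub> (I +> x) = \<one>\<^bsub>add_monoid ?L\<^esub>"
          unfolding monoid.simps partial_object.simps using mem 1 2 by blast
        show "Z = I +> (\<ominus> x)"
          if "Z \<in> carrier (add_monoid ?L) \<and>
            (I +> x) \<otimes>\<^bsub>add_monoid ?L\<^esub> Z = \<one>\<^bsub>add_monoid ?L\<^esub> \<and>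
            Z \<otimes>\<^bsub>add_monoid ?L\<^esub> (I +> x) = \<one>\<^bsub>add_monoid ?L\<^esub>" for Z
          using that unfolding monoid.simps partial_object.simps using 3 by blast
      qed
    qed
    show ?thesis
    proof (intro submodule.intro subgroup.intro submodule_axioms.intro)
      show "(+>) I ` X \<subseteq> carrier (add_monoid ?L)" using X(3) carrL by auto
      show "\<one>\<^bsub>add_monoid ?L\<^esub> \<in> (+>) I ` X" using Xs(2) zeroL by auto
      show "u \<otimes>\<^bsub>add_monoid ?L\<^esub> v \<in> (+>) I ` X"
        if "u \<in> (+>) I ` X" "v \<in> (+>) I ` X" for u v
        using that Xs(1,3) addL by auto
      show "inv\<^bsub>add_monoid ?L\<^esub> u \<in> (+>) I ` X" if "u \<in> (+>) I ` X" for u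
        using that Xs(5) inv by auto
      show "r \<odot>\<^bsub>?L\<^esub> u \<in> (+>) I ` X" if "r \<in> carrier R" "u \<in> (+>) I ` X" for r u
        using that Xs(1,6) smultL by auto
    qed
  qed
  have preimage: "ideal {x \<in> carrier R. I +> x \<in> N} R" if N: "submodule N R ?L" for N
  proof (rule idealI_cring)
    interpret N: submodule N R ?L by (rule N)
    show "\<zero> \<in> {x \<in> carrier R. I +> x \<in> N}" using N.one_closed zeroL by simp
    show "x \<oplus> y \<in> {x \<in> carrier R. I +> x \<in> N}"
      if "x \<in> {x \<in> carrier R. I +> x \<in> N}" "y \<in> {x \<in> carrier R. I +> x \<in> N}" for x y
      using that N.m_closed[of "I +> x" "I +> y"] addL[of x y] by simp
    show "r \<otimes> x \<in> {x \<in> carrier R. I +> x \<in> N}"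
      if "r \<in> carrier R" "x \<in> {x \<in> carrier R. I +> x \<in> N}" for r x
      using that N.smult_closed[of r "I +> x"] smultL[of x r] by simp
  qed auto
  have subS: "N \<subseteq> (+>) I ` ?S" if "submodule N R ?L" for N
    using subgroup.subset[OF submodule.axioms(1)[OF that]] carrL by simp
  have "interval_length {N. submodule N R ?L} {\<zero>\<^bsub>?L\<^esub>} (carrier ?L) \<le> ideal_length I ?S"
  proof (rule interval_length_transport[where f = "\<lambda>N. {x \<in> carrier R. I +> x \<in> N}"])
    show "{x \<in> carrier R. I +> x \<in> N} \<subset> {x \<in> carrier R. I +> x \<in> N'}"
      if N: "N \<subset> N'" "N' \<in> {N. submodule N R ?L}" for N N'
    proof -
      from N obtain u where u: "u \<in> N'" "u \<notin> N" by blast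
      then obtain x where "x \<in> ?S" "u = I +> x" using subS N(2) by blast
      then show ?thesis using u N(1) ideal_simps(1)[OF S] by blast
    qed
    show "I \<subseteq> {x \<in> carrier R. I +> x \<in> {\<zero>\<^bsub>?L\<^esub>}}"
      using I.a_rcos_const I.zero_closed I.Icarr zeroL by auto
    show "{x \<in> carrier R. I +> x \<in> carrier ?L} \<subseteq> ?S"
      using coset_mem[OF S IS] carrL by auto
  qed (use I S preimage in auto)
  moreover have "ideal_length I ?S \<le>
    interval_length {N. submodule N R ?L} {\<zero>\<^bsub>?L\<^esub>} (carrier ?L)"
  proof (rule interval_length_transport[where f = "\<lambda>X. (+>) I ` X"])
    show "(+>) I ` X \<in> {N. submodule N R ?L}"
      if "X \<in> {X. ideal X R}" "I \<subseteq> X" "X \<subseteq> ?S" for X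
      using submod that by simp
    show "(+>) I ` X \<subset> (+>) I ` Y"
      if XY: "X \<in> {X. ideal X R}" "Y \<in> {X. ideal X R}" "I \<subseteq> X" "X \<subset> Y" for X Y
    proof -
      from XY obtain y where y: "y \<in> Y" "y \<notin> X" by blast
      then have "I +> y \<notin> (+>) I ` X"
        using coset_mem[of X y] XY ideal_simps(1)[of Y y] by blast
      then show ?thesis using XY(4) y(1) by blast
    qed
    have "(+>) I ` I = (\<lambda>_. \<zero>\<^bsub>?L\<^esub>) ` I"
      by (rule image_cong) (simp_all add: zeroL I.a_rcos_const)
    then have "(+>) I ` I = {\<zero>\<^bsub>?L\<^esub>}"
      using I.zero_closed by (simp only: image_constant)
    then show "{\<zero>\<^bsub>?L\<^esub>} \<in> {N. submodule N R ?L}" "{\<zero>\<^bsub>?L\<^esub>} \<subseteq> (+>) I ` I"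
      using submod[OF I _ IS] by auto
    show "carrier ?L \<in> {N. submodule N R ?L}"
      using submod[OF S IS] carrL by simp
    show "(+>) I ` ?S \<subseteq> carrier ?L" using carrL by simp
  qed
  ultimately show ?thesis
    unfolding module_length_eq_interval_length by (rule antisym)
qed

section \<open>Powers of a principal ideal\<close>

lemma ideal_prod_cgenideal:
  assumes "x \<in> carrier R" "y \<in> carrier R"
  shows "(PIdl x) \<cdot> (PIdl y) = PIdl (x \<otimes> y)"
proof -
  have xy: "x \<otimes> y \<in> carrier R" using assms by simp
  have "(PIdl x) \<cdot> (PIdl y) = Idl ((PIdl x) <#> (PIdl y))"
    by (rule ideal_prod_eq_genideal) (use assms cgenideal_ideal in auto)
  also have "\<dots> = Idl (PIdl (x \<otimes> y))" using cgenideal_prod[OF assms] by simp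
  also have "\<dots> = PIdl (x \<otimes> y)"
    using genideal_minimal[OF cgenideal_ideal[OF xy] order_refl]
      genideal_self[of "PIdl (x \<otimes> y)"] ideal_simps(1)[OF cgenideal_ideal[OF xy]] by blast
  finally show ?thesis .
qed

lemma ideal_power_cgenideal:
  assumes "a \<in> carrier R"
  shows "ideal_power R (PIdl a) n = PIdl (a [^] n)"
proof (induction n)
  case 0
  have "PIdl \<one> = carrier R"
    using cgenideal_self[OF one_closed] ideal.one_imp_carrier[OF cgenideal_ideal[OF one_closed]]
    by blast
  then show ?case using ideal_power_0[of "PIdl a"] by simp
next
  case (Suc n)
  then show ?case
    unfolding ideal_power_Suc using ideal_prod_cgenideal[of "a [^] n" a] assms by simp
qed

lemma mult_image_cgenideal:
  assumes "a \<in> carrier R" "b \<in> carrier R"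
  shows "(\<lambda>x. a \<otimes> x) ` (PIdl b) = PIdl (a \<otimes> b)"
proof -
  have "a \<otimes> (r \<otimes> b) = r \<otimes> (a \<otimes> b)" if "r \<in> carrier R" for r
    using assms that by algebra
  then show ?thesis unfolding cgenideal_def by (auto simp: image_iff) metis
qed

text \<open>
  The annihilators of the powers of \<open>a\<close> form an ascending chain of ideals; beyond a maximal member
  they are all equal.
\<close>
lemma annihilator_of_powers_stable:
  assumes "noetherian_ring R" "a \<in> carrier R"
  shows "\<exists>N. \<forall>n\<ge>N. \<forall>y\<in>carrier R. a [^] Suc n \<otimes> y = \<zero> \<longrightarrow> a [^] n \<otimes> y = \<zero>"
proof -
  interpret noetherian_ring R by fact
  define ann where "ann n = {y \<in> carrier R. a [^] n \<otimes> y \<in> {\<zero>}}" for n :: nat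
  have "ideal (ann n) R" for n
    unfolding ann_def using assms(2) by (intro ideal_mult_preimage zeroideal oneideal) auto
  then have "\<exists>M\<in>range ann. \<forall>X\<in>range ann. M \<subseteq> X \<longrightarrow> X = M"
    by (intro ex_maximal_ideal_in) auto
  then obtain M where M: "M \<in> range ann" "\<forall>X\<in>range ann. M \<subseteq> X \<longrightarrow> X = M" by blast
  then obtain N where "M = ann N" by blast
  then have N: "ann N \<subseteq> ann n \<Longrightarrow> ann n = ann N" for n using M(2) by simp
  have step: "ann n \<subseteq> ann (Suc n)" for n
  proof
    fix y assume y: "y \<in> ann n"
    then have yc: "y \<in> carrier R" and "a [^] n \<otimes> y = \<zero>" by (auto simp: ann_def)
    moreover have "a [^] Suc n \<otimes> y = a \<otimes> (a [^] n \<otimes> y)"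
      using assms(2) yc by (simp add: m_ac)
    ultimately have "a [^] Suc n \<otimes> y = \<zero>" using assms(2) by (simp del: nat_pow_Suc)
    then show "y \<in> ann (Suc n)" using yc unfolding ann_def by blast
  qed
  have "ann N \<subseteq> ann n" if "n \<ge> N" for n
    using that step by (rule lift_Suc_mono_le[rotated])
  then have eq: "ann n = ann N" if "n \<ge> N" for n using N that by blast
  have "a [^] n \<otimes> y = \<zero>"
    if "n \<ge> N" "y \<in> carrier R" "a [^] Suc n \<otimes> y = \<zero>" for n y
  proof -
    have "y \<in> ann (Suc n)" using that by (simp add: ann_def)
    then have "y \<in> ann n" using eq[of n] eq[of "Suc n"] that(1) by simp
    then show ?thesis by (simp add: ann_def)
  qed
  then show ?thesis by blast
qed

text \<open>
  Write \<open>z = a\<^sup>n y\<close> and \<open>az = a\<^sup>n\<^sup>+\<^sup>2 w\<close>. Then \<open>a\<^sup>n\<^sup>+\<^sup>1\<close> annihilates \<open>y - aw\<close>, hence so does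
  \<open>a\<^sup>n\<close>, which means \<open>z = a\<^sup>n\<^sup>+\<^sup>1 w\<close>.
\<close>
lemma cgenideal_power_cancel:
  assumes a: "a \<in> carrier R"
    and ann: "\<And>y. y \<in> carrier R \<Longrightarrow> a [^] Suc n \<otimes> y = \<zero> \<Longrightarrow> a [^] n \<otimes> y = \<zero>"
    and z: "z \<in> PIdl (a [^] n)" "a \<otimes> z \<in> PIdl (a [^] Suc (Suc n))"
  shows "z \<in> PIdl (a [^] Suc n)"
proof -
  define p where "p = a [^] n"
  have p: "p \<in> carrier R" using a by (simp add: p_def)
  from z(1) obtain y where y: "y \<in> carrier R" "z = y \<otimes> p"
    by (auto simp: cgenideal_def p_def)
  from z(2) obtain w where w: "w \<in> carrier R" "a \<otimes> z = w \<otimes> (p \<otimes> a \<otimes> a)"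
    by (auto simp: cgenideal_def p_def)
  have "(p \<otimes> a) \<otimes> (y \<ominus> w \<otimes> a) = a \<otimes> (y \<otimes> p) \<ominus> w \<otimes> (p \<otimes> a \<otimes> a)"
    using p a y(1) w(1) by algebra
  also have "\<dots> = \<zero>" unfolding w(2)[symmetric] y(2) using a p y(1) by algebra
  finally have "p \<otimes> (y \<ominus> w \<otimes> a) = \<zero>"
    using ann[of "y \<ominus> w \<otimes> a"] a y(1) w(1) by (simp add: p_def)
  moreover have "z = w \<otimes> (p \<otimes> a) \<oplus> p \<otimes> (y \<ominus> w \<otimes> a)"
    unfolding y(2) using p a y(1) w(1) by algebra
  ultimately have "z = w \<otimes> (p \<otimes> a)" using p a w(1) by simp
  then show ?thesis using w(1) by (auto simp: cgenideal_def p_def)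
qed

end

section \<open>Eventual linearity\<close>

lemma eventually_constant_if_decreasing:
  fixes f :: "nat \<Rightarrow> enat"
  assumes "\<And>n. n \<ge> N \<Longrightarrow> f (Suc n) \<le> f n" "f N \<noteq> \<infinity>"
  shows "\<exists>c M. \<forall>n\<ge>M. f n = enat c"
proof -
  have anti: "f n \<le> f k" if "k \<le> n" "N \<le> k" for k n
    using that(1)
  proof (induction n rule: dec_induct)
    case (step n)
    have "f (Suc n) \<le> f n" by (rule assms(1)) (use step.hyps(1) that(2) in simp)
    then show ?case using step.IH by (rule order_trans)
  qed simp
  define x where "x = (LEAST y. y \<in> f ` {N..})"
  have "x \<in> f ` {N..}" unfolding x_def by (rule LeastI[of _ "f N"]) simp
  then obtain M where M: "M \<ge> N" "x = f M" by auto
  have const: "f n = f M" if "n \<ge> M" for n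
  proof (rule antisym)
    show "f n \<le> f M" by (rule anti[OF that M(1)])
    have "f n \<in> f ` {N..}" using that M(1) by simp
    then show "f M \<le> f n" unfolding M(2)[symmetric] x_def by (rule Least_le)
  qed
  have "f M \<noteq> \<infinity>" using anti[OF M(1) order_refl] assms(2) by (cases "f M") auto
  then obtain c where "f M = enat c" by auto
  with const show ?thesis by auto
qed

lemma linear_if_constant_increments:
  fixes g :: "nat \<Rightarrow> nat" and c d :: nat
  assumes "\<And>n. n \<ge> M \<Longrightarrow> g (Suc n) + c = g n + d"
  shows "\<exists>P :: rat poly. degree P \<le> 1 \<and> (\<forall>n\<ge>M. poly P (of_nat n) = of_nat (g n))"
proof (intro exI conjI allI impI)
  let ?e = "of_nat d - of_nat c :: rat"
  let ?P = "[:of_nat (g M) - of_nat M * ?e, ?e:]"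
  show "degree ?P \<le> 1" by simp
  fix n assume "n \<ge> M"
  then show "poly ?P (of_nat n) = of_nat (g n)"
  proof (induction n rule: dec_induct)
    case (step n)
    have "(of_nat (g (Suc n)) + of_nat c :: rat) = of_nat (g n) + of_nat d"
      using assms[OF step.hyps(1)] by (metis of_nat_add)
    with step.IH show ?case by (simp add: algebra_simps)
  qed (simp add: algebra_simps)
qed

text \<open>
  The recursion \<open>h\<^sub>n\<^sub>+\<^sub>1 + c\<^sub>n = h\<^sub>n + d\<^sub>n\<close> comes from cutting \<open>A\<^sub>n\<^sub>+\<^sub>1 \<subseteq> J\<^sub>n\<^sub>+\<^sub>1\<close> at \<open>aJ\<^sub>n\<close> and
  \<open>A\<^sub>n \<subseteq> J\<^sub>n\<close> at \<open>K\<^sub>n\<close>, since \<open>J\<^sub>n/K\<^sub>n\<close> and \<open>aJ\<^sub>n/A\<^sub>n\<^sub>+\<^sub>1\<close> have the same length.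
\<close>
theorem theorem2p2:
  fixes R :: "('a, 'b) ring_scheme" and m :: "'a set" and a :: 'a
  assumes "noetherian_local_ring R m"
    and "a \<in> carrier R"
  shows "\<exists>P :: rat poly. degree P \<le> 1 \<and>
    (\<forall>\<^sub>F n in sequentially. \<exists>k :: nat.
      h0 R m (PIdl\<^bsub>R\<^esub> a) n = enat k \<and> poly P (of_nat n) = of_nat k)"
proof -
  interpret noetherian_local_ring R m by fact
  note a = assms(2)
  have m: "ideal m R" and mm: "maximalideal m R" and noeth: "noetherian_ring R"
    using is_ideal is_maximalideal noetherian_ring_axioms by auto
  define A where "A n = PIdl\<^bsub>R\<^esub> (a [^]\<^bsub>R\<^esub> n)" for n :: nat
  define J where "J n = saturation m (A n)" for n
  define aJ where "aJ n = (\<lambda>x. a \<otimes>\<^bsub>R\<^esub> x) ` J n" for n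
  define K where "K n = {y \<in> J n. a \<otimes>\<^bsub>R\<^esub> y \<in> A (Suc n)}" for n
  define h where "h n = ideal_length (A n) (J n)" for n
  define c where "c n = ideal_length (A n) (K n)" for n
  define d where "d n = ideal_length (aJ n) (J (Suc n))" for n
  have A: "ideal (A n) R" for n unfolding A_def using a cgenideal_ideal by simp
  have J: "ideal (J n) R" for n unfolding J_def by (rule ideal_saturation[OF m A])
  have aJ: "ideal (aJ n) R" for n unfolding aJ_def by (rule ideal_mult_image[OF J a])
  have K: "ideal (K n) R" for n unfolding K_def by (rule ideal_mult_preimage[OF A J a])
  have AJ: "A n \<subseteq> J n" for n unfolding J_def by (rule subset_saturation[OF m A])
  have aA: "(\<lambda>x. a \<otimes>\<^bsub>R\<^esub> x) ` A n = A (Suc n)" for n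
    unfolding A_def using mult_image_cgenideal[OF a, of "a [^]\<^bsub>R\<^esub> n"] a
    by (simp add: m_comm)
  have A_aJ: "A (Suc n) \<subseteq> aJ n" for n
    unfolding aJ_def aA[symmetric] using AJ by blast
  have A_dec: "A (Suc n) \<subseteq> A n" for n
    unfolding aA[symmetric] by (rule image_subsetI) (rule ideal_simps(6)[OF A a])
  have J_dec: "J (Suc n) \<subseteq> J n" for n
    unfolding J_def by (rule saturation_mono[OF A_dec])
  have AK: "A n \<subseteq> K n" for n using AJ[of n] unfolding K_def aA[symmetric] by blast
  have KJ: "K n \<subseteq> J n" for n by (auto simp: K_def)
  have aJ_J: "aJ n \<subseteq> J (Suc n)" for n
    using mult_image_saturation_subset[OF m a, of "A n"] unfolding aA J_def aJ_def .
  have fin: "ideal_length X Y \<noteq> \<infinity>"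
    if "ideal X R" "ideal Y R" "X \<subseteq> Y" "A n \<subseteq> X" "Y \<subseteq> J n" for X Y n
    using finite_ideal_length_saturation[OF noeth mm that(1-3)] saturation_mono[OF that(4)] that(5)
    unfolding J_def by blast
  have fin_h: "h n \<noteq> \<infinity>" and fin_c: "c n \<noteq> \<infinity>" and fin_d: "d n \<noteq> \<infinity>" for n
    using fin[OF A J AJ order_refl order_refl, of n] fin[OF A K AK order_refl KJ, of n]
      fin[OF aJ J aJ_J A_aJ order_refl, of n]
    unfolding h_def c_def d_def by auto
  have rec: "h (Suc n) + c n = h n + d n" for n
  proof -
    have "h (Suc n) = ideal_length (A (Suc n)) (aJ n) + d n"
      unfolding h_def d_def by (rule ideal_length_additive[OF A aJ J A_aJ aJ_J])
    also have "ideal_length (A (Suc n)) (aJ n) = ideal_length (K n) (J n)"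
      using ideal_length_mult_image[OF A J AJ a, of n] unfolding aA aJ_def K_def .
    finally have "h (Suc n) + c n = (c n + ideal_length (K n) (J n)) + d n"
      by (simp add: ac_simps)
    also have "c n + ideal_length (K n) (J n) = h n"
      unfolding h_def c_def by (rule ideal_length_additive[OF A K J AK KJ, symmetric])
    finally show ?thesis .
  qed
  obtain N where N: "\<And>n y. n \<ge> N \<Longrightarrow> y \<in> carrier R \<Longrightarrow>
    a [^]\<^bsub>R\<^esub> Suc n \<otimes>\<^bsub>R\<^esub> y = \<zero>\<^bsub>R\<^esub> \<Longrightarrow> a [^]\<^bsub>R\<^esub> n \<otimes>\<^bsub>R\<^esub> y = \<zero>\<^bsub>R\<^esub>"
    using annihilator_of_powers_stable[OF noeth a] by blast
  have cancel: "z \<in> A (Suc n)" if "n \<ge> N" "z \<in> A n" "a \<otimes>\<^bsub>R\<^esub> z \<in> A (Suc (Suc n))" for n z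
    using cgenideal_power_cancel[OF a N[OF that(1)]] that(2,3) unfolding A_def by blast
  have "c (Suc n) \<le> c n" if n: "n \<ge> N" for n
    unfolding c_def
  proof (rule ideal_length_le_of_injective[OF A K A K AK A_dec AK])
    show "K (Suc n) \<subseteq> K n" using J_dec A_dec by (auto simp: K_def)
    show "A n \<inter> K (Suc n) \<subseteq> A (Suc n)" using cancel[OF n] by (auto simp: K_def)
  qed
  then obtain c0 M1 where c0: "\<forall>n\<ge>M1. c n = enat c0"
    using eventually_constant_if_decreasing[of N c] fin_c by blast
  have "d (Suc n) \<le> d n" if n: "n \<ge> N" for n
    unfolding d_def
  proof (rule ideal_length_le_of_injective[OF aJ J aJ J aJ_J _ aJ_J J_dec])
    show "aJ (Suc n) \<subseteq> aJ n" unfolding aJ_def using J_dec by blast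
    show "aJ n \<inter> J (Suc (Suc n)) \<subseteq> aJ (Suc n)"
    proof
      fix x assume x: "x \<in> aJ n \<inter> J (Suc (Suc n))"
      then obtain y where y: "y \<in> J n" "x = a \<otimes>\<^bsub>R\<^esub> y" by (auto simp: aJ_def)
      have "y \<in> saturation m (A (Suc n))"
        by (rule saturation_mult_cancel[OF m a, of "A n" "A (Suc (Suc n))"])
          (use cancel[OF n] x y in \<open>auto simp: J_def\<close>)
      then show "x \<in> aJ (Suc n)" unfolding aJ_def J_def y(2) by blast
    qed
  qed
  then obtain d0 M2 where d0: "\<forall>n\<ge>M2. d n = enat d0"
    using eventually_constant_if_decreasing[of N d] fin_d by blast
  \<comment> \<open>The function of the theorem at \<open>n\<close> refers to the ideal power \<open>n + 1\<close>.\<close>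
  define g where "g n = the_enat (h (Suc n))" for n
  have g: "h (Suc n) = enat (g n)" for n
    unfolding g_def using fin_h[of "Suc n"] by auto
  have "g (Suc n) + c0 = g n + d0" if "n \<ge> max M1 M2" for n
    using rec[of "Suc n"] c0 d0 that g by simp
  then obtain P :: "rat poly" where P: "degree P \<le> 1"
    "\<forall>n\<ge>max M1 M2. poly P (of_nat n) = of_nat (g n)"
    using linear_if_constant_increments[of "max M1 M2" g c0 d0] by blast
  have "h0 R m (PIdl\<^bsub>R\<^esub> a) n = enat (g n)" for n
    unfolding h0_def ideal_power_cgenideal[OF a] g[symmetric] h_def J_def A_def
    using length_local_cohomology0_quot[OF cgenideal_ideal m, of "a [^]\<^bsub>R\<^esub> Suc n"] a by simp
  then show ?thesis
    using P by (intro exI[of _ P] conjI eventually_sequentiallyI[of "max M1 M2"]) auto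
qed

end
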